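(* Let $k$ be a field having a primitive cube root of unity, let $(a,b,c)\in\mathfrak{D}$, and let $S=S_{a,b,c}$ be the corresponding degenerate Sklyanin algebra. \begin{enumerate} \item If $a=b$, then $S$ is isomorphic to $k\langle u,v,w\rangle/(u^2,v^2,w^2)$. \item If $a\neq b$, then $S$ is isomorphic to $k\langle u,v,w\rangle/(uv,vw,wu)$. \end{enumerate}
   Context: $k$ is a field having a primitive cube root of unity. $\mathfrak{D}\subset\mathbb{P}^2_k$ is the set of 12 points $$\mathfrak{D}=\{(1,0,0),(0,1,0),(0,0,1)\}\sqcup\{(a,b,c)\mid a^3=b^3=c^3\}.$$ For $(a,b,c)\in\mathfrak{D}$, the degenerate 3-dimensional Sklyanin algebra is $S_{a,b,c}=k\langle x,y,z\rangle/(f_1,f_2,f_3)$, where $$f_1=ayz+bzy+cx^2,\qquad f_2=azx+bxz+cy^2,\qquad f_3=axy+byx+cz^2.$$ (Up to isomorphism, in fact literally, the quotient depends only on $(a,b,c)$ up to a common nonzero scalar.) $k\langle u,v,w\rangle$ denotes the free associative $k$-algebra, and isomorphisms are isomorphisms of $k$-algebras. *)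

theory Defs
  imports
    "HOL-Algebra.Module"
    "HOL-Algebra.QuotRing"
    "HOL-Library.Poly_Mapping"
begin

text \<open>
  Words form a monoid under concatenation.  It is written additively because the convolution
  product of \<^type>\<open>poly_mapping\<close> takes its exponents in a (not necessarily commutative)
  \<^class>\<open>monoid_add\<close>.  Thus \<open>'v list \<Rightarrow>\<^sub>0 'k\<close> is the free associative algebra on the set of
  letters \<open>'v\<close>: finitely supported functions on words, multiplied by concatenating words.
\<close>

instantiation list :: (type) monoid_add
begin

definition zero_list :: "'a list" where "zero_list = []"

definition plus_list :: "'a list \<Rightarrow> 'a list \<Rightarrow> 'a list" where "plus_list = (@)"

instance by standard (simp_all add: zero_list_def plus_list_def)

end

definition scalar :: "'k::field \<Rightarrow> ('v list \<Rightarrow>\<^sub>0 'k)"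
  where "scalar c = Poly_Mapping.single [] c"

definition var :: "'v \<Rightarrow> ('v list \<Rightarrow>\<^sub>0 'k::field)"
  where "var v = Poly_Mapping.single [v] 1"

text \<open>
  Algebras over the field \<open>'k\<close> are represented by records of type \<^type>\<open>module\<close>, which extend rings
  by a scalar multiplication; the carrier of \<open>'k\<close> is the whole type.  The locale \<open>algebra\<close> of the
  library is not applicable, since it requires the ring to be commutative.
\<close>

definition free_algebra :: "('k::field, 'v list \<Rightarrow>\<^sub>0 'k) module"
  where "free_algebra =
    \<lparr>carrier = UNIV, mult = (*), one = 1, zero = 0, add = (+), smult = (\<lambda>c p. scalar c * p)\<rparr>"

definition quot_algebra ::
    "('k, 'a, 'm) module_scheme \<Rightarrow> 'a set \<Rightarrow> ('k, 'a set) module"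
  where "quot_algebra A I =
    ring.extend (A Quot I) (module.fields (\<lambda>c P. \<Union>p\<in>P. I +>\<^bsub>A\<^esub> (c \<odot>\<^bsub>A\<^esub> p)))"

definition presented_algebra ::
    "('v list \<Rightarrow>\<^sub>0 'k::field) set \<Rightarrow> ('k, ('v list \<Rightarrow>\<^sub>0 'k) set) module"
  where "presented_algebra R = quot_algebra free_algebra (Idl\<^bsub>free_algebra\<^esub> R)"

definition algebra_iso ::
    "('k, 'a, 'm) module_scheme \<Rightarrow> ('k, 'b, 'n) module_scheme \<Rightarrow> ('a \<Rightarrow> 'b) set"
  where "algebra_iso A B =
    {h \<in> ring_iso A B. \<forall>c. \<forall>x\<in>carrier A. h (c \<odot>\<^bsub>A\<^esub> x) = c \<odot>\<^bsub>B\<^esub> h x}"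

definition is_algebra_iso ::
    "('k, 'a, 'm) module_scheme \<Rightarrow> ('k, 'b, 'n) module_scheme \<Rightarrow> bool" (infix "\<cong>\<^sub>a\<^sub>l\<^sub>g" 60)
  where "A \<cong>\<^sub>a\<^sub>l\<^sub>g B \<longleftrightarrow> algebra_iso A B \<noteq> {}"

definition primitive_root_of_unity :: "nat \<Rightarrow> 'k::field \<Rightarrow> bool"
  where "primitive_root_of_unity n \<omega> \<longleftrightarrow>
    0 < n \<and> \<omega> ^ n = 1 \<and> (\<forall>m. 0 < m \<and> m < n \<longrightarrow> \<omega> ^ m \<noteq> 1)"

text \<open>
  A point of the projective plane is the set of its homogeneous coordinate triples.
\<close>

definition proj_pt :: "'k::field \<Rightarrow> 'k \<Rightarrow> 'k \<Rightarrow> ('k \<times> 'k \<times> 'k) set"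
  where "proj_pt a b c = {(t * a, t * b, t * c) | t. t \<noteq> 0}"

definition degenerate_points :: "('k::field \<times> 'k \<times> 'k) set set" ("\<DD>")
  where "\<DD> = {proj_pt 1 0 0, proj_pt 0 1 0, proj_pt 0 0 1} \<union>
    {proj_pt a b c | a b c. (a, b, c) \<noteq> (0, 0, 0) \<and> a ^ 3 = b ^ 3 \<and> b ^ 3 = c ^ 3}"

datatype xyz = X | Y | Z
datatype uvw = U | V | W

definition sklyanin :: "'k::field \<Rightarrow> 'k \<Rightarrow> 'k \<Rightarrow> ('k, (xyz list \<Rightarrow>\<^sub>0 'k) set) module"
  where "sklyanin a b c =
    (let x = var X; y = var Y; z = var Z in presented_algebra
      {scalar a * y * z + scalar b * z * y + scalar c * x ^ 2,
       scalar a * z * x + scalar b * x * z + scalar c * y ^ 2,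
       scalar a * x * y + scalar b * y * x + scalar c * z ^ 2})"


text \<open>
  Consistency checks: the free algebra is a ring, scalar multiplication on the quotient is the
  induced one, and \<open>\<DD>\<close> has twelve elements.
\<close>

lemma free_algebra_simps [simp]:
  "carrier free_algebra = UNIV"
  "p \<otimes>\<^bsub>free_algebra\<^esub> q = p * q"
  "p \<oplus>\<^bsub>free_algebra\<^esub> q = p + q"
  "\<one>\<^bsub>free_algebra\<^esub> = 1"
  "\<zero>\<^bsub>free_algebra\<^esub> = 0"
  "c \<odot>\<^bsub>free_algebra\<^esub> p = scalar c * p"
  by (simp_all add: free_algebra_def)

lemma ring_free_algebra: "ring (free_algebra :: ('k::field, 'v list \<Rightarrow>\<^sub>0 'k) module)"
proof -
  have "\<exists>q. q + p = 0 \<and> p + q = 0" for p :: "'v list \<Rightarrow>\<^sub>0 'k"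
    by (intro exI [of _ "- p"]) simp
  then show ?thesis
    by unfold_locales (auto simp: algebra_simps Units_def)
qed

lemma scalar_commute:
  fixes p :: "'v list \<Rightarrow>\<^sub>0 'k::field"
  shows "scalar c * p = p * scalar c"
proof (intro poly_mapping_eqI)
  fix k :: "'v list"
  have "(\<Sum>v. c when [] = v when k = u @ v) = (c when k = u)" for u :: "'v list"
  proof -
    have "(\<Sum>v. c when [] = v when k = u @ v) = (\<Sum>v :: 'v list. (c when k = u) when v = [])"
      by (intro arg_cong [of _ _ Sum_any] ext) (auto simp: when_def)
    then show ?thesis by simp
  qed
  then show "Poly_Mapping.lookup (scalar c * p) k = Poly_Mapping.lookup (p * scalar c) k"
    by (simp add: scalar_def lookup_mult lookup_single plus_list_def when_mult mult_when mult.commute)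
qed

lemma smult_presented_algebra:
  fixes R :: "('v list \<Rightarrow>\<^sub>0 'k::field) set"
  defines "I \<equiv> Idl\<^bsub>(free_algebra :: ('k, 'v list \<Rightarrow>\<^sub>0 'k) module)\<^esub> R"
  shows "c \<odot>\<^bsub>presented_algebra R\<^esub> (I +>\<^bsub>(free_algebra :: ('k, 'v list \<Rightarrow>\<^sub>0 'k) module)\<^esub> p) =
    I +>\<^bsub>(free_algebra :: ('k, 'v list \<Rightarrow>\<^sub>0 'k) module)\<^esub> (scalar c * p)"
proof -
  let ?F = "free_algebra :: ('k, 'v list \<Rightarrow>\<^sub>0 'k) module"
  interpret F: ring ?F
    by (rule ring_free_algebra)
  interpret I: ideal I ?F
    unfolding I_def by (rule F.genideal_ideal) simp
  have coset: "I +>\<^bsub>?F\<^esub> q = {i + q | i. i \<in> I}" for q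
    by (auto simp: a_r_coset_def r_coset_def)
  have zero: "0 \<in> I"
    using I.additive_subgroup_axioms additive_subgroup.zero_closed by fastforce
  have "I +>\<^bsub>?F\<^esub> (scalar c * q) = I +>\<^bsub>?F\<^esub> (scalar c * p)" if "q \<in> I +>\<^bsub>?F\<^esub> p" for q
  proof -
    from that obtain i where i: "i \<in> I" "q = i + p"
      by (auto simp: coset)
    then have "scalar c * q \<in> I +>\<^bsub>?F\<^esub> (scalar c * p)"
      using I.I_l_closed [of i "scalar c"] by (auto simp: coset algebra_simps)
    then show ?thesis
      using F.a_repr_independence [OF _ _ I.a_subgroup] by simp
  qed
  moreover have "p \<in> I +>\<^bsub>?F\<^esub> p"
    using zero by (force simp: coset)
  ultimately have "(\<Union>q\<in>I +>\<^bsub>?F\<^esub> p. I +>\<^bsub>?F\<^esub> (scalar c * q)) = I +>\<^bsub>?F\<^esub> (scalar c * p)"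
    by (intro UN_constant_eq ballI)
  then show ?thesis
    by (simp add: presented_algebra_def quot_algebra_def ring.defs module.defs I_def)
qed

lemma proj_pt_eq_iff:
  "proj_pt a b c = proj_pt a' b' c' \<longleftrightarrow> (\<exists>t. t \<noteq> 0 \<and> a' = t * a \<and> b' = t * b \<and> c' = t * c)"
proof
  assume "proj_pt a b c = proj_pt a' b' c'"
  moreover have "(a', b', c') \<in> proj_pt a' b' c'"
    unfolding proj_pt_def by (auto intro!: exI [of _ 1])
  ultimately have "(a', b', c') \<in> proj_pt a b c"
    by simp
  then show "\<exists>t. t \<noteq> 0 \<and> a' = t * a \<and> b' = t * b \<and> c' = t * c"
    unfolding proj_pt_def by blast
next
  assume "\<exists>t. t \<noteq> 0 \<and> a' = t * a \<and> b' = t * b \<and> c' = t * c"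
  then obtain t where t: "t \<noteq> 0" "a' = t * a" "b' = t * b" "c' = t * c"
    by blast
  have "\<exists>s'. (s * a, s * b, s * c) = (s' * a', s' * b', s' * c') \<and> s' \<noteq> 0" if "s \<noteq> 0" for s
    using t that by (intro exI [of _ "s / t"]) auto
  moreover have "\<exists>s'. (s * a', s * b', s * c') = (s' * a, s' * b, s' * c) \<and> s' \<noteq> 0" if "s \<noteq> 0" for s
    using t that by (intro exI [of _ "s * t"]) auto
  ultimately show "proj_pt a b c = proj_pt a' b' c'"
    unfolding proj_pt_def by blast
qed

lemma card_degenerate_points:
  assumes "primitive_root_of_unity 3 (\<omega>::'k::field)"
  shows "card (\<DD> :: ('k \<times> 'k \<times> 'k) set set) = 12"
proof -
  define C where "C = {1, \<omega>, \<omega> ^ 2}"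
  define P where "P = (\<lambda>(b, c). proj_pt (1::'k) b c)"
  have w: "\<omega> ^ 3 = 1" "\<omega> \<noteq> 1" "\<omega> ^ 2 \<noteq> 1" "\<omega> \<noteq> 0"
    using assms by (auto simp: primitive_root_of_unity_def dest: spec [of _ 1])
  then have w2: "\<omega> ^ 2 \<noteq> \<omega>"
    by (simp add: power2_eq_square)
  have "(\<omega> - 1) * (\<omega> ^ 2 + \<omega> + 1) = 0"
    using w(1) by (simp add: algebra_simps power2_eq_square power3_eq_cube)
  then have w3: "\<omega> ^ 2 + \<omega> + 1 = 0"
    using w(2) by simp
  have C: "x ^ 3 = 1 \<longleftrightarrow> x \<in> C" for x
  proof -
    have "x ^ 3 - 1 - (x - 1) * (x - \<omega>) * (x - \<omega> ^ 2) = (\<omega> ^ 2 + \<omega> + 1) * (x ^ 2 - \<omega> * x) + (\<omega> ^ 3 - 1)"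
      by (simp add: algebra_simps power2_eq_square power3_eq_cube)
    then have "x ^ 3 - 1 = (x - 1) * (x - \<omega>) * (x - \<omega> ^ 2)"
      using w3 w(1) by simp
    moreover have "x ^ 3 = 1 \<longleftrightarrow> x ^ 3 - 1 = 0"
      by simp
    moreover have "(x - 1) * (x - \<omega>) * (x - \<omega> ^ 2) = 0 \<longleftrightarrow> x \<in> C"
      by (simp add: C_def)
    ultimately show ?thesis
      by (simp only:)
  qed
  have cardC: "card C = 3"
    using w w2 by (auto simp: C_def)
  have "inj_on P (C \<times> C)"
    by (auto simp: P_def inj_on_def proj_pt_eq_iff)
  then have 9: "card (P ` (C \<times> C)) = 9"
    by (simp add: card_image card_cartesian_product cardC)
  have eq: "(\<DD> :: ('k \<times> 'k \<times> 'k) set set) =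
      insert (proj_pt 1 0 0) (insert (proj_pt 0 1 0) (insert (proj_pt 0 0 1) (P ` (C \<times> C))))"
  proof -
    have "{proj_pt a b c | a b c. (a, b, c) \<noteq> (0, 0, 0) \<and> a ^ 3 = b ^ 3 \<and> b ^ 3 = c ^ 3} = P ` (C \<times> C)"
      (is "?L = _")
    proof
      show "P ` (C \<times> C) \<subseteq> ?L"
      proof clarify
        fix b c :: 'k
        assume "b \<in> C" "c \<in> C"
        then have "(1 :: 'k, b, c) \<noteq> (0, 0, 0) \<and> 1 ^ 3 = b ^ 3 \<and> b ^ 3 = c ^ 3"
          by (simp add: C [symmetric])
        then show "\<exists>a' b' c'. P (b, c) = proj_pt a' b' c' \<and> (a', b', c') \<noteq> (0, 0, 0) \<and>
            a' ^ 3 = b' ^ 3 \<and> b' ^ 3 = c' ^ 3"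
          unfolding P_def prod.case by (intro exI conjI) (rule refl, auto)
      qed
      show "?L \<subseteq> P ` (C \<times> C)"
      proof
        fix p
        assume "p \<in> ?L"
        then obtain a b c where p: "p = proj_pt a b c"
          and nz: "(a, b, c) \<noteq> (0, 0, 0)" and eq: "a ^ 3 = b ^ 3" "b ^ 3 = c ^ 3"
          by blast
        have a: "a \<noteq> 0"
          using nz eq by (auto simp: power_0_left)
        then have "c \<noteq> 0"
          using eq by auto
        then have "(b / a, c / a) \<in> C \<times> C"
          using eq by (simp add: power_divide flip: C)
        moreover have "proj_pt a b c = P (b / a, c / a)"
          using a unfolding P_def prod.case proj_pt_eq_iff by (intro exI [of _ "1 / a"]) simp
        ultimately show "p \<in> P ` (C \<times> C)"
          unfolding p by (simp only: image_eqI)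
      qed
    qed
    then show ?thesis
      unfolding degenerate_points_def by (simp only: Un_insert_left sup_bot_left)
  qed
  have "0 \<notin> C"
    by (simp add: w flip: C)
  then have "proj_pt 1 0 0 \<notin> P ` (C \<times> C)" "proj_pt 0 1 0 \<notin> P ` (C \<times> C)" "proj_pt 0 0 1 \<notin> P ` (C \<times> C)"
    unfolding P_def by (auto simp: proj_pt_eq_iff)
  moreover have "finite (P ` (C \<times> C))"
    by (simp add: C_def)
  moreover have "proj_pt 1 0 0 \<noteq> proj_pt (0::'k) 1 0" "proj_pt 1 0 0 \<noteq> proj_pt (0::'k) 0 1"
    "proj_pt 0 1 0 \<noteq> proj_pt (0::'k) 0 1"
    by (auto simp: proj_pt_eq_iff)
  ultimately show ?thesis
    using 9 unfolding eq by (subst card_insert_disjoint; simp)+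
qed

end

theory Submission
  imports Defs
begin

text \<open>
  The two kinds of degenerate points behave differently.  At a coordinate point each relation is a
  scalar multiple of one word of length two, and renaming the letters gives the required
  relations.

  At a point with \<open>a\<^sup>3 = b\<^sup>3 = c\<^sup>3 \<noteq> 0\<close> put \<open>q = b / a\<close> and \<open>r = c / a\<close>, which are cube roots of unity.
  The space spanned by \<open>f\<^sub>1, f\<^sub>2, f\<^sub>3\<close> is then spanned by products of two linear forms.  Indeed, let
  \<open>l(t) = x + t y + q\<^sup>2 r\<^sup>2 t\<^sup>2 z\<close> for a cube root of unity \<open>t\<close>.  Expanding the product gives
  \<open>a l(q t) l(t) = r\<^sup>2 f\<^sub>1 + t f\<^sub>3 + q r\<^sup>2 t\<^sup>2 f\<^sub>2\<close>.
  As \<open>t\<close> runs through the three cube roots of unity, both the passage from \<open>x, y, z\<close> to the forms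
  \<open>l(t)\<close> and the passage from \<open>f\<^sub>1, f\<^sub>2, f\<^sub>3\<close> to the products \<open>l(q t) l(t)\<close> are given by a Fourier
  matrix of order three with rescaled columns.  This matrix is invertible, because a field with a
  primitive cube root of unity does not have characteristic three.  So taking the \<open>l(t)\<close> as new
  letters identifies the two free algebras and turns the Sklyanin relations into the words
  (letter of \<open>q t\<close>)(letter of \<open>t\<close>).  If \<open>a = b\<close>, then \<open>q = 1\<close> and these are the squares of the
  letters.  If \<open>a \<noteq> b\<close>, then \<open>q\<close> is itself a primitive cube root of unity, multiplication by \<open>q\<close>
  permutes the letters cyclically, and the words are \<open>u v, v w, w u\<close>.

  The computation is in \<open>linear_forms_product\<close>, the inversion of the matrix in
  \<open>fourier_left_inverse\<close> and \<open>fourier_right_inverse\<close>, and \<open>presented_algebra_iso\<close> turns mutually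
  inverse substitutions that respect the relations into isomorphisms of the quotients.
\<close>

section \<open>Substitution homomorphisms of free algebras\<close>

lemma scalar_0 [simp]: "scalar 0 = 0"
  by (simp add: scalar_def)

lemma scalar_1 [simp]: "scalar 1 = 1"
  by (simp add: scalar_def zero_list_def flip: single_one)

lemma scalar_add: "scalar (c + d) = scalar c + scalar d"
  by (simp add: scalar_def single_add)

lemma scalar_mult: "scalar (c * d) = scalar c * scalar d"
  by (simp add: scalar_def mult_single plus_list_def)

lemma scalar_sum: "scalar (\<Sum>i\<in>A. f i) = (\<Sum>i\<in>A. scalar (f i))"
  by (induction A rule: infinite_finite_induct) (simp_all add: scalar_add)

lemma scalar_left_commute: "p * (scalar c * q) = scalar c * (p * q)"
  for p :: "'v list \<Rightarrow>\<^sub>0 'k::field"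
  by (metis mult.assoc scalar_commute)

lemma single_eq_scalar_mult:
  "Poly_Mapping.single w (c::'k::field) = scalar c * prod_list (map var w)"
proof -
  have "prod_list (map var w) = Poly_Mapping.single w (1::'k)"
    by (induction w) (simp_all add: var_def mult_single plus_list_def zero_list_def flip: single_one)
  then show ?thesis
    by (simp add: scalar_def mult_single plus_list_def)
qed

text \<open>
  The free algebra is spanned by words.  Writing a basis element as a product of letters makes the
  induction usable for homomorphisms, which are known on scalars and letters.
\<close>

lemma free_algebra_induct [case_names zero add monomial]:
  fixes p :: "'v list \<Rightarrow>\<^sub>0 'k::field"
  assumes "P 0" and add: "\<And>p q. P p \<Longrightarrow> P q \<Longrightarrow> P (p + q)"
    and monomial: "\<And>w c. P (scalar c * prod_list (map var w))"
  shows "P p"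
proof (induction p rule: update_induct)
  case const
  show ?case by fact
next
  case (update p w c)
  have "Poly_Mapping.update w c p = Poly_Mapping.single w c + p"
    using update(1)
    by (intro poly_mapping_eqI)
      (auto simp: lookup_update lookup_add lookup_single when_def in_keys_iff)
  then show ?case
    using add monomial update by (simp add: single_eq_scalar_mult)
qed

text \<open>
  The homomorphism given by the universal property of the free algebra.
\<close>

definition subst :: "('v \<Rightarrow> ('w list \<Rightarrow>\<^sub>0 'k)) \<Rightarrow> ('v list \<Rightarrow>\<^sub>0 'k::field) \<Rightarrow> ('w list \<Rightarrow>\<^sub>0 'k)"
  where "subst f p =
    (\<Sum>w\<in>Poly_Mapping.keys p. scalar (Poly_Mapping.lookup p w) * prod_list (map f w))"

lemma subst_0 [simp]: "subst f 0 = 0"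
  by (simp add: subst_def)

lemma subst_add [simp]: "subst f (p + q) = subst f p + subst f q"
  unfolding subst_def
  by (rule setsum_keys_plus_distrib) (simp_all add: scalar_add distrib_right)

lemma subst_single: "subst f (Poly_Mapping.single w c) = scalar c * prod_list (map f w)"
  by (simp add: subst_def)

lemma subst_scalar [simp]: "subst f (scalar c) = scalar c"
  unfolding scalar_def subst_single by (simp add: scalar_def)

lemma subst_1 [simp]: "subst f 1 = 1"
  by (metis scalar_1 subst_scalar)

lemma subst_var [simp]: "subst f (var v) = f v"
  by (simp add: var_def subst_single)

lemma subst_mult [simp]: "subst f (p * q) = subst f p * subst f q"
proof (induction p rule: free_algebra_induct)
  case zero
  show ?case by simp
next
  case (add p p')
  then show ?case by (simp add: distrib_right)
next
  case (monomial u c)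
  show ?case
  proof (induction q rule: free_algebra_induct)
    case zero
    show ?case by simp
  next
    case (add q q')
    then show ?case by (simp add: distrib_left)
  next
    case (monomial w d)
    show ?case
      by (simp add: mult_single subst_single plus_list_def scalar_mult mult.assoc
          scalar_left_commute [of "prod_list (map f u)"] flip: single_eq_scalar_mult)
  qed
qed

lemma subst_sum [simp]: "subst f (\<Sum>i\<in>A. p i) = (\<Sum>i\<in>A. subst f (p i))"
  by (induction A rule: infinite_finite_induct) simp_all

text \<open>
  A homomorphism from a free algebra is determined by the images of the letters, so that inverse
  substitutions can be recognised on letters.
\<close>

lemma subst_inverse:
  assumes "\<And>v. subst f (g v) = var v"
  shows "subst f (subst g p) = p"
proof (induction p rule: free_algebra_induct)
  case zero
  show ?case by simp
next
  case (add p q)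
  then show ?case by simp
next
  case (monomial w c)
  have "subst f (subst g (prod_list (map var w))) = prod_list (map var w)"
    by (induction w) (simp_all add: assms)
  then show ?case by simp
qed


section \<open>Isomorphisms of presented algebras\<close>

abbreviation relation_ideal :: "('v list \<Rightarrow>\<^sub>0 'k::field) set \<Rightarrow> ('v list \<Rightarrow>\<^sub>0 'k) set"
  where "relation_ideal R \<equiv> Idl\<^bsub>free_algebra\<^esub> R"

lemma ideal_relation_ideal: "ideal (relation_ideal R) free_algebra"
  by (rule ring.genideal_ideal [OF ring_free_algebra]) simp

lemma relation_in_ideal: "r \<in> R \<Longrightarrow> r \<in> relation_ideal R"
  using ring.genideal_self [OF ring_free_algebra, of R] by auto

lemma relation_ideal_0: "0 \<in> relation_ideal R"
  using additive_subgroup.zero_closed [OF ideal.axioms(1) [OF ideal_relation_ideal [of R]]] by simp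

lemma relation_ideal_add:
  "p \<in> relation_ideal R \<Longrightarrow> q \<in> relation_ideal R \<Longrightarrow> p + q \<in> relation_ideal R"
  using additive_subgroup.a_closed [OF ideal.axioms(1) [OF ideal_relation_ideal [of R]]] by simp

lemma relation_ideal_mult_left: "p \<in> relation_ideal R \<Longrightarrow> q * p \<in> relation_ideal R"
  using ideal.I_l_closed [OF ideal_relation_ideal [of R]] by simp

lemma relation_ideal_sum:
  "(\<And>i. i \<in> A \<Longrightarrow> p i \<in> relation_ideal R) \<Longrightarrow> (\<Sum>i\<in>A. p i) \<in> relation_ideal R"
  by (induction A rule: infinite_finite_induct) (simp_all add: relation_ideal_0 relation_ideal_add)

lemma ring_hom_ring_subst: "ring_hom_ring free_algebra free_algebra (subst f)"
  by (rule ring_hom_ringI [OF ring_free_algebra ring_free_algebra]) simp_all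

text \<open>
  The preimage of an ideal under a homomorphism is an ideal; if it contains the generators, it
  contains the ideal that they generate.
\<close>

lemma subst_relation_ideal:
  assumes R: "\<And>r. r \<in> R \<Longrightarrow> subst f r \<in> relation_ideal R'" and p: "p \<in> relation_ideal R"
  shows "subst f p \<in> relation_ideal R'"
proof -
  have "ideal {p \<in> carrier free_algebra. subst f p \<in> relation_ideal R'} free_algebra"
    by (rule ring_hom_ring.ideal_vimage [OF ring_hom_ring_subst ideal_relation_ideal])
  then have "relation_ideal R \<subseteq> {p. subst f p \<in> relation_ideal R'}"
    using R by (intro ring.genideal_minimal [OF ring_free_algebra]) auto
  then show ?thesis
    using p by blast
qed

text \<open>
  The composite of \<open>subst f\<close> with the projection onto the second quotient is surjective, since
  \<open>subst f\<close> has a right inverse.  Its kernel is the ideal of \<open>R\<close>: one inclusion holds because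
  \<open>subst f\<close> maps this ideal into that of \<open>R'\<close>, the other because \<open>subst g\<close> maps back.  The
  homomorphism theorem then gives the isomorphism.
\<close>

lemma presented_algebra_iso:
  fixes f :: "'v \<Rightarrow> ('w list \<Rightarrow>\<^sub>0 'k::field)" and g :: "'w \<Rightarrow> ('v list \<Rightarrow>\<^sub>0 'k)"
  assumes gf: "\<And>v. subst g (f v) = var v" and fg: "\<And>w. subst f (g w) = var w"
    and R: "\<And>r. r \<in> R \<Longrightarrow> subst f r \<in> relation_ideal R'"
    and R': "\<And>r. r \<in> R' \<Longrightarrow> subst g r \<in> relation_ideal R"
  shows "presented_algebra R \<cong>\<^sub>a\<^sub>l\<^sub>g presented_algebra R'"
proof -
  let ?F = "free_algebra :: ('k, 'v list \<Rightarrow>\<^sub>0 'k) module"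
  let ?F' = "free_algebra :: ('k, 'w list \<Rightarrow>\<^sub>0 'k) module"
  define I where "I = relation_ideal R"
  define I' where "I' = relation_ideal R'"
  define h where "h p = I' +>\<^bsub>?F'\<^esub> subst f p" for p
  interpret I: ideal I ?F
    unfolding I_def by (rule ideal_relation_ideal)
  interpret I': ideal I' ?F'
    unfolding I'_def by (rule ideal_relation_ideal)
  have "h \<in> ring_hom ?F (?F' Quot I')"
    using ring_hom_trans [OF ring_hom_ring.homh [OF ring_hom_ring_subst] I'.rcos_ring_hom, of f]
    by (simp add: h_def [abs_def] comp_def)
  then interpret h: ring_hom_ring ?F "?F' Quot I'" h
    by (intro ring_hom_ringI2 ring_free_algebra I'.quotient_is_ring)
  have "subst f p \<in> I' \<longleftrightarrow> p \<in> I" for p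
    using subst_relation_ideal [OF R, where p = p]
      subst_relation_ideal [OF R', where p = "subst f p"]
    by (auto simp: I_def I'_def subst_inverse [of g f, OF gf])
  moreover have "h p = \<zero>\<^bsub>?F' Quot I'\<^esub> \<longleftrightarrow> subst f p \<in> I'" for p
    using I'.a_rcos_const [of "subst f p"] I'.a_rcos_self [of "subst f p"]
    by (auto simp: h_def FactRing_def)
  ultimately have ker: "a_kernel ?F (?F' Quot I') h = I"
    unfolding a_kernel_def' by simp
  have "surj (subst f)"
    by (rule surjI) (rule subst_inverse [OF fg])
  moreover have "range h = (\<lambda>q. I' +>\<^bsub>?F'\<^esub> q) ` range (subst f)"
    by (simp add: h_def [abs_def] image_image)
  ultimately have "range h = range (\<lambda>q. I' +>\<^bsub>?F'\<^esub> q)"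
    by simp
  also have "\<dots> = carrier (?F' Quot I')"
    by (auto simp: FactRing_def A_RCOSETS_def')
  finally have "h ` carrier ?F = carrier (?F' Quot I')"
    by simp
  then have iso: "(\<lambda>P. the_elem (h ` P)) \<in> ring_iso (?F Quot I) (?F' Quot I')"
    using h.FactRing_iso_set by (simp add: ker)
  have "the_elem (h ` (c \<odot>\<^bsub>presented_algebra R\<^esub> P)) =
      c \<odot>\<^bsub>presented_algebra R'\<^esub> the_elem (h ` P)"
    if "P \<in> carrier (?F Quot I)" for c P
  proof -
    from that obtain p where P: "P = I +>\<^bsub>?F\<^esub> p"
      by (auto simp: FactRing_def A_RCOSETS_def')
    have elem: "the_elem (h ` (I +>\<^bsub>?F\<^esub> q)) = h q" for q
      using h.the_elem_simp [of q] by (simp add: ker)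
    show ?thesis
      unfolding P smult_presented_algebra [of R, folded I_def] elem
      by (simp add: h_def I'_def smult_presented_algebra)
  qed
  moreover have "ring_iso (presented_algebra R) (presented_algebra R') =
      ring_iso (?F Quot I) (?F' Quot I')"
    and "carrier (presented_algebra R) = carrier (?F Quot I)"
    by (simp_all add: presented_algebra_def quot_algebra_def ring.defs I_def I'_def
        ring_iso_def ring_hom_def)
  ultimately show ?thesis
    using iso unfolding is_algebra_iso_def algebra_iso_def by auto
qed

text \<open>
  This covers the three coordinate points, whose relations are words with a common coefficient.
\<close>

lemma presented_algebra_scale_relabel:
  assumes "a \<noteq> 0" and "\<And>v. g (f v) = v" and "\<And>w. f (g w) = w"
  shows "presented_algebra ((\<lambda>r. scalar a * r) ` R) \<cong>\<^sub>a\<^sub>l\<^sub>g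
    presented_algebra (subst (\<lambda>v. var (f v)) ` R)"
proof (rule presented_algebra_iso [where f = "\<lambda>v. var (f v)" and g = "\<lambda>w. var (g w)"])
  fix r
  assume "r \<in> (\<lambda>r. scalar a * r) ` R"
  then obtain s where "s \<in> R" "r = scalar a * s"
    by blast
  then show "subst (\<lambda>v. var (f v)) r \<in> relation_ideal (subst (\<lambda>v. var (f v)) ` R)"
    by (simp add: relation_ideal_mult_left relation_in_ideal)
next
  fix r'
  assume "r' \<in> subst (\<lambda>v. var (f v)) ` R"
  then obtain r where r: "r \<in> R" "subst (\<lambda>w. var (g w)) r' = r"
    by (auto simp: subst_inverse assms)
  have "r = scalar (1 / a) * (scalar a * r)"
    using assms(1) by (simp flip: mult.assoc scalar_mult)
  also have "\<dots> \<in> relation_ideal ((\<lambda>r. scalar a * r) ` R)"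
    using r(1) by (blast intro: relation_ideal_mult_left relation_in_ideal)
  finally show "subst (\<lambda>w. var (g w)) r' \<in> relation_ideal ((\<lambda>r. scalar a * r) ` R)"
    by (simp add: r(2))
qed (simp_all add: assms)


section \<open>The Fourier matrix of order three\<close>

instance xyz :: finite
  by standard (rule finite_subset [of _ "{X, Y, Z}"], use xyz.exhaust in auto)

instance uvw :: finite
  by standard (rule finite_subset [of _ "{U, V, W}"], use uvw.exhaust in auto)

lemma UNIV_xyz: "UNIV = {X, Y, Z}"
  using xyz.exhaust by auto

lemma UNIV_uvw: "UNIV = {U, V, W}"
  using uvw.exhaust by auto

text \<open>
  A left inverse of the coefficient matrix solves a linear system.  The unknowns are arbitrary
  elements of a free algebra, so that this applies to the letters as well as to the relations.
\<close>

lemma linear_system_inverse: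
  fixes g :: "'w::finite \<Rightarrow> ('x list \<Rightarrow>\<^sub>0 'k::field)" and B :: "'w \<Rightarrow> 'v::finite \<Rightarrow> 'k"
  assumes "\<And>w'. (\<Sum>v\<in>UNIV. B w v * A v w') = (if w = w' then 1 else 0)"
  shows "(\<Sum>v\<in>UNIV. scalar (B w v) * (\<Sum>w'\<in>UNIV. scalar (A v w') * g w')) = g w"
proof -
  have "(\<Sum>v\<in>UNIV. scalar (B w v) * (\<Sum>w'\<in>UNIV. scalar (A v w') * g w')) =
      (\<Sum>v\<in>UNIV. \<Sum>w'\<in>UNIV. scalar (B w v * A v w') * g w')"
    by (simp add: sum_distrib_left scalar_mult mult.assoc)
  also have "\<dots> = (\<Sum>w'\<in>UNIV. scalar (\<Sum>v\<in>UNIV. B w v * A v w') * g w')"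
    by (subst sum.swap) (simp add: scalar_sum sum_distrib_right)
  also have "\<dots> = (\<Sum>w'\<in>UNIV. if w = w' then g w' else 0)"
    unfolding assms by (intro sum.cong) auto
  also have "\<dots> = g w"
    by simp
  finally show ?thesis .
qed

text \<open>
  The three cube roots of unity, attached to the new letters in the order for which multiplication
  by \<open>\<omega>\<close> maps \<open>w\<close> to \<open>v\<close>, \<open>v\<close> to \<open>u\<close> and \<open>u\<close> to \<open>w\<close>.
\<close>

fun node :: "'k::field \<Rightarrow> uvw \<Rightarrow> 'k"
  where "node \<omega> U = \<omega> ^ 2" | "node \<omega> V = \<omega>" | "node \<omega> W = 1"

text \<open>
  The degrees of the letters in a grading by the integers modulo three, for which the defining
  relations of the Sklyanin algebras are homogeneous.
\<close>

fun weight :: "xyz \<Rightarrow> nat"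
  where "weight X = 0" | "weight Y = 1" | "weight Z = 2"

definition fourier :: "'k::field \<Rightarrow> (xyz \<Rightarrow> 'k) \<Rightarrow> uvw \<Rightarrow> xyz \<Rightarrow> 'k"
  where "fourier \<omega> d i j = d j * node \<omega> i ^ weight j"

text \<open>
  The exponent \<open>2 * weight j\<close> stands for \<open>- weight j\<close>, which is the same modulo three.
\<close>

definition fourier_inv :: "'k::field \<Rightarrow> (xyz \<Rightarrow> 'k) \<Rightarrow> xyz \<Rightarrow> uvw \<Rightarrow> 'k"
  where "fourier_inv \<omega> d j i = node \<omega> i ^ (2 * weight j) / (3 * d j)"

lemma sum_powers_cube_root_of_unity:
  fixes x :: "'k::field"
  assumes "x ^ 3 = 1"
  shows "1 + x + x ^ 2 = (if x = 1 then 3 else 0)"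
proof -
  have "(x - 1) * (1 + x + x ^ 2) = x ^ 3 - 1"
    by (simp add: algebra_simps power2_eq_square power3_eq_cube)
  then show ?thesis
    using assms by auto
qed

text \<open>
  Since \<open>1 + \<omega> + \<omega>\<^sup>2 = 0\<close>, the square of \<open>\<omega> - 1\<close> is \<open>- 3 \<omega>\<close>; this excludes characteristic three.
\<close>

lemma primitive_cube_root:
  fixes \<omega> :: "'k::field"
  assumes "primitive_root_of_unity 3 \<omega>"
  shows "\<omega> ^ 3 = 1" and "\<omega> \<noteq> 1" and "\<omega> ^ 2 \<noteq> 1" and "(3::'k) \<noteq> 0"
proof -
  show 1: "\<omega> ^ 3 = 1" and 2: "\<omega> \<noteq> 1" and "\<omega> ^ 2 \<noteq> 1"
    using assms by (auto simp: primitive_root_of_unity_def dest: spec [of _ 1])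
  have "1 + \<omega> + \<omega> ^ 2 = 0"
    using sum_powers_cube_root_of_unity [OF 1] 2 by simp
  moreover have "(\<omega> - 1) ^ 2 = (1 + \<omega> + \<omega> ^ 2) - 3 * \<omega>"
    by (simp add: power2_diff)
  ultimately show "(3::'k) \<noteq> 0"
    using 2 by auto
qed

lemma primitive_cube_root_powers:
  fixes \<omega> :: "'k::field"
  assumes "primitive_root_of_unity 3 \<omega>"
  shows "\<omega> ^ 4 = \<omega>" and "\<omega> ^ 5 = \<omega> ^ 2" and "\<omega> ^ 6 = 1"
  using power_add [of \<omega> 3 1] power_add [of \<omega> 3 2] power_add [of \<omega> 3 3]
    primitive_cube_root(1) [OF assms]
  by simp_all

lemma node_power_3: "\<omega> ^ 3 = 1 \<Longrightarrow> node \<omega> i ^ 3 = 1"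
  using power_add [of \<omega> 3 3] by (cases i) (simp_all flip: power_mult)

lemma fourier_left_inverse:
  assumes "primitive_root_of_unity 3 \<omega>" and "\<And>j. d j \<noteq> 0"
  shows "(\<Sum>i\<in>UNIV. fourier_inv \<omega> d j i * fourier \<omega> d i j') = (if j = j' then 1 else 0)"
proof -
  note \<omega> = primitive_cube_root [OF assms(1)] primitive_cube_root_powers [OF assms(1)]
  \<comment> \<open>The sum over the nodes is the sum of the powers of \<open>\<omega> ^ n\<close>, with \<open>n\<close> the difference of the
    weights modulo three.\<close>
  define n where "n = 2 * weight j + weight j'"
  have "(\<Sum>i\<in>UNIV. fourier_inv \<omega> d j i * fourier \<omega> d i j') =
      d j' / (3 * d j) * (\<Sum>i\<in>UNIV. node \<omega> i ^ n)"
    by (simp add: fourier_def fourier_inv_def n_def sum_distrib_left power_add mult_ac)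
  also have "(\<Sum>i\<in>UNIV. node \<omega> i ^ n) = 1 + \<omega> ^ n + (\<omega> ^ n) ^ 2"
    by (simp add: UNIV_uvw add_ac mult.commute flip: power_mult)
  also have "\<dots> = (if \<omega> ^ n = 1 then 3 else 0)"
    by (rule sum_powers_cube_root_of_unity)
      (metis \<omega>(1) mult.commute power_mult power_one)
  also have "\<omega> ^ n = 1 \<longleftrightarrow> j = j'"
    by (cases j; cases j') (simp_all add: n_def \<omega> \<omega>(3) [unfolded power2_eq_square])
  finally show ?thesis
    using \<omega>(4) assms(2) by simp
qed

lemma fourier_right_inverse:
  assumes "primitive_root_of_unity 3 \<omega>" and "\<And>j. d j \<noteq> 0"
  shows "(\<Sum>j\<in>UNIV. fourier \<omega> d i j * fourier_inv \<omega> d j i') = (if i = i' then 1 else 0)"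
proof -
  note \<omega> = primitive_cube_root [OF assms(1)] primitive_cube_root_powers [OF assms(1)]
  \<comment> \<open>The quotient of the two nodes, as squaring a cube root of unity inverts it.\<close>
  define u where "u = node \<omega> i * node \<omega> i' ^ 2"
  have "u ^ 3 = (node \<omega> i ^ 3) * (node \<omega> i' ^ 3) ^ 2"
    by (simp add: u_def power_mult_distrib flip: power_mult)
  then have u: "u ^ 3 = 1"
    by (simp add: node_power_3 \<omega>)
  have "(\<Sum>j\<in>UNIV. fourier \<omega> d i j * fourier_inv \<omega> d j i') = (1 + u + u ^ 2) / 3"
    using assms(2)
    by (simp add: UNIV_xyz fourier_def fourier_inv_def u_def power_mult_distrib add_divide_distrib
        flip: power_mult)
  also have "1 + u + u ^ 2 = (if u = 1 then 3 else 0)"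
    by (rule sum_powers_cube_root_of_unity [OF u])
  also have "u = 1 \<longleftrightarrow> i = i'"
    by (cases i; cases i')
      (simp_all add: u_def \<omega> \<omega>(3) [unfolded power2_eq_square] flip: power_mult power_add power_Suc power_Suc2)
  finally show ?thesis
    using \<omega>(4) by auto
qed


section \<open>The Sklyanin relations as products of linear forms\<close>

text \<open>
  Each relation is indexed by the letter of the same weight modulo three.  This puts
  \<open>a x y + b y x + c z\<^sup>2\<close> at \<open>Y\<close> and \<open>a z x + b x z + c y\<^sup>2\<close> at \<open>Z\<close>, and makes the coefficients of
  the relations in the products of linear forms a rescaled Fourier matrix.
\<close>

fun sklyanin_relation :: "'k::field \<Rightarrow> 'k \<Rightarrow> 'k \<Rightarrow> xyz \<Rightarrow> (xyz list \<Rightarrow>\<^sub>0 'k)"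
  where
    "sklyanin_relation a b c X =
      scalar a * var Y * var Z + scalar b * var Z * var Y + scalar c * var X ^ 2"
  | "sklyanin_relation a b c Y =
      scalar a * var X * var Y + scalar b * var Y * var X + scalar c * var Z ^ 2"
  | "sklyanin_relation a b c Z =
      scalar a * var Z * var X + scalar b * var X * var Z + scalar c * var Y ^ 2"

lemma sklyanin_eq: "sklyanin a b c = presented_algebra (range (sklyanin_relation a b c))"
  by (simp add: sklyanin_def UNIV_xyz Let_def insert_commute)

text \<open>
  The nine words of length two are distributed over the three relations, each occurring in exactly
  one of them.  So a product of linear forms is a combination of the relations as soon as its nine
  coefficients match.
\<close>

lemma linear_form_product:
  fixes a b c :: "'k::field"
  assumes "\<alpha> Y * \<beta> Z = \<rho> X * a" "\<alpha> Z * \<beta> Y = \<rho> X * b" "\<alpha> X * \<beta> X = \<rho> X * c"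
    and "\<alpha> X * \<beta> Y = \<rho> Y * a" "\<alpha> Y * \<beta> X = \<rho> Y * b" "\<alpha> Z * \<beta> Z = \<rho> Y * c"
    and "\<alpha> Z * \<beta> X = \<rho> Z * a" "\<alpha> X * \<beta> Z = \<rho> Z * b" "\<alpha> Y * \<beta> Y = \<rho> Z * c"
  shows "(\<Sum>j\<in>UNIV. scalar (\<alpha> j) * var j) * (\<Sum>j\<in>UNIV. scalar (\<beta> j) * var j) =
    (\<Sum>j\<in>UNIV. scalar (\<rho> j) * sklyanin_relation a b c j)"
proof -
  have monomial: "scalar s * var i * (scalar t * var j) = scalar (s * t) * (var i * var j)"
    for s t :: 'k and i j :: xyz
    by (simp add: scalar_mult mult.assoc scalar_left_commute [of "var i"])
  have coeff: "scalar (\<rho> i) * (scalar s * p) = scalar (\<rho> i * s) * p"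
    for i s and p :: "xyz list \<Rightarrow>\<^sub>0 'k"
    by (simp add: scalar_mult mult.assoc)
  show ?thesis
    by (simp add: UNIV_xyz distrib_left distrib_right monomial assms)
      (simp add: coeff mult.assoc power2_eq_square)
qed

text \<open>
  The factor \<open>q\<^sup>2 r\<^sup>2\<close> at \<open>z\<close> is forced: with coefficients \<open>1, t, s t\<^sup>2\<close> and \<open>1, q t, s q\<^sup>2 t\<^sup>2\<close>, the
  words \<open>x\<^sup>2\<close> and \<open>y z\<close> require \<open>1 = r s q\<close>.  The other coefficients then match because
  \<open>q\<close>, \<open>r\<close> and \<open>t\<close> are cube roots of unity.
\<close>

lemma linear_forms_product:
  fixes a q r \<omega> :: "'k::field" and \<sigma> :: "uvw \<Rightarrow> uvw"
  defines "l \<equiv> \<lambda>i. \<Sum>j\<in>UNIV. scalar (fourier \<omega> (case_xyz 1 1 (q ^ 2 * r ^ 2)) i j) * var j"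
  assumes \<omega>: "\<omega> ^ 3 = 1" and a: "a \<noteq> 0" and q: "q ^ 3 = 1" and r: "r ^ 3 = 1"
    and \<sigma>: "node \<omega> (\<sigma> i) = q * node \<omega> i"
  shows "l (\<sigma> i) * l i =
    (\<Sum>j\<in>UNIV. scalar (fourier \<omega> (case_xyz (r ^ 2 / a) (1 / a) (q * r ^ 2 / a)) i j) *
      sklyanin_relation a (a * q) (a * r) j)"
proof -
  define t where "t = node \<omega> i"
  have t: "t ^ 3 = 1"
    unfolding t_def by (rule node_power_3 [OF \<omega>])
  \<comment> \<open>Rewriting with these rules modulo commutativity reduces all exponents below three.\<close>
  have reduce: "x * (x * x) = 1" "x * (x * (x * y)) = y" if "x ^ 3 = 1" for x y :: 'k
    using that by (simp_all add: power3_eq_cube flip: mult.assoc)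
  show ?thesis
    unfolding l_def
    by (rule linear_form_product)
      (use a in \<open>simp_all add: fourier_def \<sigma> power_mult_distrib power2_eq_square mult_ac
        reduce [OF q] reduce [OF r] reduce [OF t] flip: t_def\<close>)
qed

text \<open>
  The permutation \<open>\<sigma>\<close> of the new letters is multiplication by \<open>q\<close> on the nodes.  Treating \<open>\<sigma>\<close> as a
  parameter handles \<open>a = b\<close> and \<open>a \<noteq> b\<close> together.
\<close>

lemma sklyanin_iso_products:
  fixes a q r \<omega> :: "'k::field" and \<sigma> :: "uvw \<Rightarrow> uvw"
  assumes \<omega>: "primitive_root_of_unity 3 \<omega>"
    and a: "a \<noteq> 0" and q: "q ^ 3 = 1" and r: "r ^ 3 = 1"
    and \<sigma>: "\<And>i. node \<omega> (\<sigma> i) = q * node \<omega> i"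
  shows "sklyanin a (a * q) (a * r) \<cong>\<^sub>a\<^sub>l\<^sub>g presented_algebra (range (\<lambda>i. var (\<sigma> i) * var i))"
proof -
  define d where "d = case_xyz 1 1 (q ^ 2 * r ^ 2)"
  define e where "e = case_xyz (r ^ 2 / a) (1 / a) (q * r ^ 2 / a)"
  let ?f = "sklyanin_relation a (a * q) (a * r)"
  have nz: "q \<noteq> 0" "r \<noteq> 0"
    using q r by auto
  have d: "d j \<noteq> 0" and e: "e j \<noteq> 0" for j
    using a nz by (cases j; simp add: d_def e_def)+
  \<comment> \<open>The linear forms, and the old letters expressed in the new ones.\<close>
  define l :: "uvw \<Rightarrow> (xyz list \<Rightarrow>\<^sub>0 'k)"
    where "l i = (\<Sum>j\<in>UNIV. scalar (fourier \<omega> d i j) * var j)" for i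
  define m :: "xyz \<Rightarrow> (uvw list \<Rightarrow>\<^sub>0 'k)"
    where "m j = (\<Sum>i\<in>UNIV. scalar (fourier_inv \<omega> d j i) * var i)" for j
  have ml: "subst m (l i) = var i" for i
    unfolding l_def by (simp add: m_def linear_system_inverse fourier_right_inverse \<omega> d)
  have lm: "subst l (m j) = var j" for j
    unfolding m_def by (simp add: l_def linear_system_inverse fourier_left_inverse \<omega> d)
  have prod: "l (\<sigma> i) * l i = (\<Sum>j\<in>UNIV. scalar (fourier \<omega> e i j) * ?f j)" for i
    unfolding l_def d_def e_def
    by (rule linear_forms_product [OF primitive_cube_root(1) [OF \<omega>] a q r \<sigma>])
  have rel: "?f j = (\<Sum>i\<in>UNIV. scalar (fourier_inv \<omega> e j i) * (l (\<sigma> i) * l i))" for j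
    unfolding prod by (simp add: linear_system_inverse fourier_left_inverse \<omega> e)
  show ?thesis
    unfolding sklyanin_eq
  proof (rule presented_algebra_iso [where f = m and g = l])
    fix p
    assume "p \<in> range ?f"
    then obtain j where "p = ?f j"
      by blast
    then have "subst m p = (\<Sum>i\<in>UNIV. scalar (fourier_inv \<omega> e j i) * (var (\<sigma> i) * var i))"
      by (simp add: rel ml)
    then show "subst m p \<in> relation_ideal (range (\<lambda>i. var (\<sigma> i) * var i))"
      by (simp add: relation_ideal_sum relation_ideal_mult_left relation_in_ideal)
  next
    fix p
    assume "p \<in> range (\<lambda>i. var (\<sigma> i) * var i :: uvw list \<Rightarrow>\<^sub>0 'k)"
    then obtain i where "p = var (\<sigma> i) * var i"
      by blast
    then show "subst l p \<in> relation_ideal (range ?f)"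
      by (simp add: prod relation_ideal_sum relation_ideal_mult_left relation_in_ideal)
  qed (fact lm ml)+
qed


section \<open>The twelve degenerate points\<close>

text \<open>
  The conditions do not change when the coordinates are multiplied by a common nonzero factor, so
  that they pass from the chosen representatives to all homogeneous coordinates.
\<close>

lemma degenerate_points_cases:
  assumes "proj_pt a b c \<in> \<DD>"
  obtains "a \<noteq> 0" "b = 0" "c = 0" | "a = 0" "b \<noteq> 0" "c = 0" | "a = 0" "b = 0" "c \<noteq> 0"
    | "a \<noteq> 0" "a ^ 3 = b ^ 3" "b ^ 3 = c ^ 3"
proof -
  from assms consider "proj_pt a b c = proj_pt 1 0 0" | "proj_pt a b c = proj_pt 0 1 0"
    | "proj_pt a b c = proj_pt 0 0 1"
    | a' b' c' where "proj_pt a' b' c' = proj_pt a b c" "(a', b', c') \<noteq> (0, 0, 0)"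
      "a' ^ 3 = b' ^ 3" "b' ^ 3 = c' ^ 3"
    unfolding degenerate_points_def Un_iff insert_iff empty_iff mem_Collect_eq by metis
  then show thesis
  proof cases
    case 1
    then have "a \<noteq> 0" "b = 0" "c = 0"
      by (auto simp: proj_pt_eq_iff)
    then show thesis
      using that(1) by blast
  next
    case 2
    then have "b \<noteq> 0" "a = 0" "c = 0"
      by (auto simp: proj_pt_eq_iff)
    then show thesis
      using that(2) by blast
  next
    case 3
    then have "c \<noteq> 0" "a = 0" "b = 0"
      by (auto simp: proj_pt_eq_iff)
    then show thesis
      using that(3) by blast
  next
    case 4
    have "a' \<noteq> 0"
      using 4 by auto
    then show thesis
      using 4 that(4) by (auto simp: proj_pt_eq_iff power_mult_distrib)
  qed
qed

theorem theorem1p1: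
  fixes a b c :: "'k::field"
  assumes "\<exists>\<omega>::'k. primitive_root_of_unity 3 \<omega>"
    and "proj_pt a b c \<in> \<DD>"
  shows "(a = b \<longrightarrow> sklyanin a b c \<cong>\<^sub>a\<^sub>l\<^sub>g
            presented_algebra {var U ^ 2, var V ^ 2, var W ^ 2}) \<and>
         (a \<noteq> b \<longrightarrow> sklyanin a b c \<cong>\<^sub>a\<^sub>l\<^sub>g
            presented_algebra {var U * var V, var V * var W, var W * var U})"
  using assms(2)
proof (cases rule: degenerate_points_cases)
  case 1
  let ?R = "{var X * var Y, var Y * var Z, var Z * var X} :: (xyz list \<Rightarrow>\<^sub>0 'k) set"
  have "sklyanin a b c = presented_algebra ((\<lambda>p. scalar a * p) ` ?R)"
    unfolding sklyanin_def Let_def 1 by (simp add: mult.assoc) (simp add: insert_commute)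
  moreover have "subst (\<lambda>v. var (case_xyz U V W v)) ` ?R = {var U * var V, var V * var W, var W * var U}"
    by simp
  moreover have "case_uvw X Y Z (case_xyz U V W v) = v" for v
    by (cases v) simp_all
  moreover have "case_xyz U V W (case_uvw X Y Z w) = w" for w
    by (cases w) simp_all
  ultimately show ?thesis
    using presented_algebra_scale_relabel [of a "case_uvw X Y Z" "case_xyz U V W" ?R] 1 by auto
next
  case 2
  let ?R = "{var X * var Z, var Z * var Y, var Y * var X} :: (xyz list \<Rightarrow>\<^sub>0 'k) set"
  have "sklyanin a b c = presented_algebra ((\<lambda>p. scalar b * p) ` ?R)"
    unfolding sklyanin_def Let_def 2 by (simp add: mult.assoc) (simp add: insert_commute)
  moreover have "subst (\<lambda>v. var (case_xyz U W V v)) ` ?R = {var U * var V, var V * var W, var W * var U}"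
    by simp
  moreover have "case_uvw X Z Y (case_xyz U W V v) = v" for v
    by (cases v) simp_all
  moreover have "case_xyz U W V (case_uvw X Z Y w) = w" for w
    by (cases w) simp_all
  ultimately show ?thesis
    using presented_algebra_scale_relabel [of b "case_uvw X Z Y" "case_xyz U W V" ?R] 2 by auto
next
  case 3
  let ?R = "{var X ^ 2, var Y ^ 2, var Z ^ 2} :: (xyz list \<Rightarrow>\<^sub>0 'k) set"
  have "sklyanin a b c = presented_algebra ((\<lambda>p. scalar c * p) ` ?R)"
    unfolding sklyanin_def Let_def 3 by simp
  moreover have "subst (\<lambda>v. var (case_xyz U V W v)) ` ?R = {var U ^ 2, var V ^ 2, var W ^ 2}"
    by (simp add: power2_eq_square)
  moreover have "case_uvw X Y Z (case_xyz U V W v) = v" for v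
    by (cases v) simp_all
  moreover have "case_xyz U V W (case_uvw X Y Z w) = w" for w
    by (cases w) simp_all
  ultimately show ?thesis
    using presented_algebra_scale_relabel [of c "case_uvw X Y Z" "case_xyz U V W" ?R] 3 by auto
next
  case 4
  define q r where "q = b / a" and "r = c / a"
  have eq: "a * q = b" "a * r = c" and q: "q ^ 3 = 1" and r: "r ^ 3 = 1"
    using 4 by (auto simp: q_def r_def power_divide)
  note iso = sklyanin_iso_products [OF _ \<open>a \<noteq> 0\<close> q r, unfolded eq]
  show ?thesis
  proof (cases "a = b")
    case True
    \<comment> \<open>Here \<open>q = 1\<close>, so that the words are squares for any choice of \<open>\<omega>\<close>.\<close>
    from assms(1) obtain \<omega> :: 'k where "primitive_root_of_unity 3 \<omega>"
      by blast
    then show ?thesis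
      using iso [of \<omega> "\<lambda>i. i"] True \<open>a \<noteq> 0\<close>
      by (simp add: UNIV_uvw power2_eq_square q_def)
  next
    case False
    \<comment> \<open>Taking \<open>\<omega> = q\<close> fixes the direction of the cyclic permutation.\<close>
    have "q \<noteq> 1"
      using False eq by auto
    have "q ^ m \<noteq> 1" if "0 < m" "m < 3" for m
    proof -
      have "m = 1 \<or> m = 2"
        using that by auto
      then show ?thesis
        using q \<open>q \<noteq> 1\<close> by (auto simp: eval_nat_numeral)
    qed
    then have "primitive_root_of_unity 3 q"
      using q by (simp add: primitive_root_of_unity_def)
    moreover have "node q (case_uvw W U V i) = q * node q i" for i
      using q by (cases i) (simp_all add: eval_nat_numeral)
    ultimately show ?thesis
      using iso [of q "case_uvw W U V"] False
      by (simp add: UNIV_uvw) (simp add: insert_commute)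
  qed
qed

end
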